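(* Let $S>0$ and let $\theta:[0,\infty)\times\mathbb{R}\to\mathbb{R}$ be a smooth solution of the sine-Gordon equation $\theta_{\tau s}=\sin\theta$ under the boundary condition $$\theta(\tau,s+S)=\theta(\tau,s)+2n\pi\qquad(\forall\tau\in[0,\infty),\ \forall s\in\mathbb{R})$$ for some $n\in\mathbb{Z}$. Let $(x(\tau,s),u(\tau,s))$ be the curve obtained from $\theta$ by $$x(\tau,s)=x(\tau,0)+\int_0^s\cos\theta(\tau,\sigma)\,\mathrm{d}\sigma,\qquad u(\tau,s)=u(\tau,0)+\int_0^s\sin\theta(\tau,\sigma)\,\mathrm{d}\sigma ,$$ with $(x(\tau,0),u(\tau,0))$ satisfying $$x_\tau(\tau,0)=-\frac{(\theta_\tau(\tau,0))^2}{2},\qquad u(\tau,0)=\theta_\tau(\tau,0).$$ Then the periodic boundary condition $$x(\tau,s+S)=x(\tau,s)+L,\qquad u(\tau,s+S)=u(\tau,s)\qquad(\forall\tau\in[0,\infty),\ \forall s\in\mathbb{R})$$ holds.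
   Context: Subscripts denote partial derivatives. $L$ is the constant length of the spatial period in the physical domain, given by the initial curve: $L=x(0,S)-x(0,0)$ (independent of $\tau$). *)

theory Defs
  imports "HOL-Analysis.Analysis"
begin

text \<open>
  Functions on the half plane \<open>[0,\<infinity>) \<times> \<real>\<close> are represented as curried total functions; values at
  negative \<open>\<tau>\<close> never matter, because the \<open>\<tau>\<close>-derivative is taken within \<open>[0,\<infinity>)\<close>, and so is
  one-sided at \<open>\<tau> = 0\<close>.
\<close>

definition D_tau :: "(real \<Rightarrow> real \<Rightarrow> real) \<Rightarrow> real \<Rightarrow> real \<Rightarrow> real" where
  "D_tau f \<tau> s = vector_derivative (\<lambda>t. f t s) (at \<tau> within {0..})"

definition D_s :: "(real \<Rightarrow> real \<Rightarrow> real) \<Rightarrow> real \<Rightarrow> real \<Rightarrow> real" where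
  "D_s f \<tau> s = vector_derivative (\<lambda>\<sigma>. f \<tau> \<sigma>) (at s)"

text \<open>
  \<open>C_half_plane k f\<close>: all partial derivatives of \<open>f\<close> up to order \<open>k\<close>, in any order of
  differentiation, exist and are jointly continuous on \<open>[0,\<infinity>) \<times> \<real>\<close>, boundary included.
\<close>

primrec C_half_plane :: "nat \<Rightarrow> (real \<Rightarrow> real \<Rightarrow> real) \<Rightarrow> bool" where
  "C_half_plane 0 f \<longleftrightarrow> continuous_on ({0..} \<times> UNIV) (\<lambda>(\<tau>, s). f \<tau> s)"
| "C_half_plane (Suc k) f \<longleftrightarrow>
     continuous_on ({0..} \<times> UNIV) (\<lambda>(\<tau>, s). f \<tau> s) \<and>
     (\<forall>\<tau>\<ge>0. \<forall>s. (\<lambda>t. f t s) differentiable (at \<tau> within {0..})) \<and>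
     (\<forall>\<tau>\<ge>0. \<forall>s. (\<lambda>\<sigma>. f \<tau> \<sigma>) differentiable (at s)) \<and>
     C_half_plane k (D_tau f) \<and> C_half_plane k (D_s f)"

definition smooth_half_plane :: "(real \<Rightarrow> real \<Rightarrow> real) \<Rightarrow> bool" where
  "smooth_half_plane f \<longleftrightarrow> (\<forall>k. C_half_plane k f)"

end

theory Submission
  imports Defs
begin

text \<open>
  Everything rests on the identity \<open>u = \<theta>\<^sub>\<tau>\<close>. The sine-Gordon equation says that
  \<open>\<theta>\<^sub>\<tau>\<close> is an antiderivative of \<open>sin \<theta>\<close> in \<open>s\<close>, and \<open>u\<close> is another one; the two agree at
  \<open>s = 0\<close> by the choice of the base point. Differentiating the boundary condition
  in \<open>\<tau>\<close> kills the constant \<open>2n\<pi>\<close>, so \<open>\<theta>\<^sub>\<tau>\<close>, and with it \<open>u\<close>, is periodic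
  (\<open>D_tau_shift\<close>, \<open>integral_sin_sine_Gordon\<close>).

  For \<open>x\<close>, let \<open>I(\<tau>)\<close> be the integral of \<open>cos \<theta>\<close> over \<open>[0,S]\<close>. As \<open>cos \<theta>\<close> is periodic in \<open>s\<close>, a shift
  of \<open>s\<close> by one period increases \<open>x(\<tau>,s)\<close> by \<open>I(\<tau>)\<close> (\<open>interval_integral_add_period\<close>). It remains
  to see that \<open>I\<close> is constant. Differentiation under the integral gives
  \<open>I' = - \<integral> \<theta>\<^sub>\<tau> sin \<theta> = - \<integral> \<theta>\<^sub>\<tau> \<theta>\<^sub>\<tau>\<^sub>s\<close>, whose integrand is the \<open>s\<close>-derivative of
  \<open>\<theta>\<^sub>\<tau>\<^sup>2 / 2\<close>; hence \<open>I' = 0\<close> by the periodicity of \<open>\<theta>\<^sub>\<tau>\<close>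
  (\<open>integral_cos_sine_Gordon_constant\<close>). So \<open>I(\<tau>) = I(0) = L\<close>.
\<close>

lemma smooth_half_plane_continuous:
  assumes "smooth_half_plane f"
  shows "continuous_on ({0..} \<times> UNIV) (\<lambda>(\<tau>, s). f \<tau> s)"
  using assms unfolding smooth_half_plane_def by (metis C_half_plane.simps(1))

lemma smooth_half_plane_D_tau:
  assumes "smooth_half_plane f"
  shows "smooth_half_plane (D_tau f)"
  using assms unfolding smooth_half_plane_def by (metis C_half_plane.simps(2))

lemma smooth_half_plane_has_derivative_tau:
  assumes "smooth_half_plane f" "\<tau> \<ge> 0"
  shows "((\<lambda>t. f t s) has_real_derivative D_tau f \<tau> s) (at \<tau> within {0..})"
proof -
  have "(\<lambda>t. f t s) differentiable (at \<tau> within {0..})"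
    using assms unfolding smooth_half_plane_def by (metis C_half_plane.simps(2))
  then show ?thesis
    unfolding D_tau_def has_real_derivative_iff_has_vector_derivative
    by (simp add: vector_derivative_works)
qed

lemma smooth_half_plane_has_derivative_s:
  assumes "smooth_half_plane f" "\<tau> \<ge> 0"
  shows "(f \<tau> has_real_derivative D_s f \<tau> s) (at s within A)"
proof -
  have "f \<tau> differentiable (at s)"
    using assms unfolding smooth_half_plane_def by (metis C_half_plane.simps(2))
  then have "(f \<tau> has_real_derivative D_s f \<tau> s) (at s)"
    unfolding D_s_def has_real_derivative_iff_has_vector_derivative
    by (simp add: vector_derivative_works)
  then show ?thesis
    by (rule has_field_derivative_at_within)
qed

lemma smooth_half_plane_continuous_s:
  assumes "smooth_half_plane f" "\<tau> \<ge> 0"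
  shows "continuous_on A (f \<tau>)"
  using smooth_half_plane_has_derivative_s[OF assms] by (rule DERIV_continuous_on)

lemma D_tau_shift:
  assumes smooth: "smooth_half_plane f" and "\<tau> \<ge> 0"
    and shift: "\<And>t. t \<ge> 0 \<Longrightarrow> f t (s + S) = f t s + c"
  shows "D_tau f \<tau> (s + S) = D_tau f \<tau> s"
proof -
  have "((\<lambda>t. f t s + c) has_real_derivative D_tau f \<tau> s) (at \<tau> within {0..})"
    using smooth_half_plane_has_derivative_tau[OF smooth \<open>\<tau> \<ge> 0\<close>, of s]
    by (auto intro!: derivative_eq_intros)
  then have "((\<lambda>t. f t (s + S)) has_real_derivative D_tau f \<tau> s) (at \<tau> within {0..})"
    by (rule has_field_derivative_transform_within[where d = 1])
      (use \<open>\<tau> \<ge> 0\<close> shift in auto)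
  moreover have "at \<tau> within {0..} \<noteq> bot"
    using at_within_Ici_at_right \<open>\<tau> \<ge> 0\<close>
    by (metis at_le atLeast_subset_iff le_bot trivial_limit_at_right_real)
  ultimately show ?thesis
    unfolding D_tau_def has_real_derivative_iff_has_vector_derivative
    by (simp add: vector_derivative_within)
qed

text \<open>
  With a global antiderivative \<open>F\<close> the claim reads \<open>F(s + S) - F(s) = F(S) - F(0)\<close>, and the left side
  has \<open>s\<close>-derivative \<open>f(s + S) - f(s) = 0\<close>. Working with \<open>F\<close> treats negative \<open>s\<close> on the same footing.
\<close>
lemma interval_integral_add_period:
  fixes f :: "real \<Rightarrow> real"
  assumes cont: "continuous_on UNIV f" and period: "\<And>s. f (s + S) = f s"
  shows "(LBINT \<sigma>=ereal 0..ereal (s + S). f \<sigma>) =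
    (LBINT \<sigma>=ereal 0..ereal s. f \<sigma>) + (LBINT \<sigma>=ereal 0..ereal S. f \<sigma>)"
proof -
  obtain F where F: "\<And>s. (F has_vector_derivative f s) (at s)"
    using einterval_antiderivative[of "-\<infinity>" "\<infinity>" f] cont
    by (auto simp: continuous_on_eq_continuous_at)
  have FTC: "(LBINT \<sigma>=ereal 0..ereal r. f \<sigma>) = F r - F 0" for r
    by (rule interval_integral_FTC_finite)
      (use cont F in \<open>auto intro: continuous_on_subset has_vector_derivative_at_within\<close>)
  have F': "(F has_real_derivative f s) (at s)" for s
    using F by (simp add: has_real_derivative_iff_has_vector_derivative)
  have "((\<lambda>s. F (s + S) - F s) has_real_derivative f (r + S) - f r) (at r)" for r
    by (intro DERIV_diff iffD1[OF DERIV_shift] F')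
  then have "((\<lambda>s. F (s + S) - F s) has_real_derivative 0) (at r)" for r
    by (simp add: period)
  then have "F (s + S) - F s = F (0 + S) - F 0"
    by (intro DERIV_isconst_all) blast
  then show ?thesis
    by (simp add: FTC)
qed

lemma integral_sin_sine_Gordon:
  assumes smooth: "smooth_half_plane \<theta>" and "\<tau> \<ge> 0"
    and sine_Gordon: "\<And>s. D_s (D_tau \<theta>) \<tau> s = sin (\<theta> \<tau> s)"
  shows "(LBINT \<sigma>=ereal 0..ereal s. sin (\<theta> \<tau> \<sigma>)) = D_tau \<theta> \<tau> s - D_tau \<theta> \<tau> 0"
proof (rule interval_integral_FTC_finite)
  show "continuous_on {min 0 s..max 0 s} (\<lambda>\<sigma>. sin (\<theta> \<tau> \<sigma>))"
    by (intro continuous_on_sin smooth_half_plane_continuous_s smooth \<open>\<tau> \<ge> 0\<close>)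
  show "(D_tau \<theta> \<tau> has_vector_derivative sin (\<theta> \<tau> r)) (at r within {min 0 s..max 0 s})" for r
    using smooth_half_plane_has_derivative_s[OF smooth_half_plane_D_tau[OF smooth] \<open>\<tau> \<ge> 0\<close>]
    by (simp add: has_real_derivative_iff_has_vector_derivative flip: sine_Gordon)
qed

text \<open>
  The quantity \<open>\<integral> cos \<theta>\<close> is conserved because its density has the local conservation law
  \<open>(cos \<theta>)\<^sub>\<tau> + (\<theta>\<^sub>\<tau>\<^sup>2 / 2)\<^sub>s = 0\<close>, and the flux \<open>\<theta>\<^sub>\<tau>\<^sup>2 / 2\<close> has equal values at both ends.
\<close>
lemma integral_cos_sine_Gordon_constant:
  assumes smooth: "smooth_half_plane \<theta>" and "\<tau> \<ge> 0" and "S \<ge> 0"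
    and sine_Gordon: "\<And>t s. t \<ge> 0 \<Longrightarrow> D_s (D_tau \<theta>) t s = sin (\<theta> t s)"
    and flux: "\<And>t. t \<ge> 0 \<Longrightarrow> (D_tau \<theta> t S)\<^sup>2 = (D_tau \<theta> t 0)\<^sup>2"
  shows "(LBINT \<sigma>=ereal 0..ereal S. cos (\<theta> \<tau> \<sigma>)) = (LBINT \<sigma>=ereal 0..ereal S. cos (\<theta> 0 \<sigma>))"
proof -
  define I where "I t = integral (cbox 0 S) (\<lambda>\<sigma>. cos (\<theta> t \<sigma>))" for t
  note smooth' = smooth_half_plane_D_tau[OF smooth]
  have cont: "continuous_on ({0..} \<times> cbox 0 S) (\<lambda>(t, \<sigma>). g t \<sigma>)"
    if "smooth_half_plane g" for g
    using smooth_half_plane_continuous[OF that] by (rule continuous_on_subset) auto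
  have "(I has_real_derivative 0) (at t within {0..})" if "t \<ge> 0" for t
  proof -
    have "(I has_real_derivative integral (cbox 0 S) (\<lambda>\<sigma>. - sin (\<theta> t \<sigma>) * D_tau \<theta> t \<sigma>))
        (at t within {0..})"
      unfolding I_def
    proof (rule leibniz_rule_field_derivative)
      show "((\<lambda>t. cos (\<theta> t \<sigma>)) has_real_derivative - sin (\<theta> r \<sigma>) * D_tau \<theta> r \<sigma>)
          (at r within {0..})" if "r \<in> {0..}" for r \<sigma>
        using smooth_half_plane_has_derivative_tau[OF smooth, of r \<sigma>] that
        by (auto intro!: derivative_eq_intros)
      show "(\<lambda>\<sigma>. cos (\<theta> r \<sigma>)) integrable_on cbox 0 S" if "r \<in> {0..}" for r
        by (intro integrable_continuous continuous_on_cos smooth_half_plane_continuous_s smooth)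
          (use that in auto)
      show "continuous_on ({0..} \<times> cbox 0 S) (\<lambda>(r, \<sigma>). - sin (\<theta> r \<sigma>) * D_tau \<theta> r \<sigma>)"
        using cont[OF smooth] cont[OF smooth'] unfolding case_prod_beta
        by (intro continuous_intros)
    qed (use \<open>t \<ge> 0\<close> in auto)
    moreover have "((\<lambda>\<sigma>. - sin (\<theta> t \<sigma>) * D_tau \<theta> t \<sigma>) has_integral
        - (D_tau \<theta> t S)\<^sup>2 / 2 - - (D_tau \<theta> t 0)\<^sup>2 / 2) {0..S}"
    proof (rule fundamental_theorem_of_calculus[OF \<open>S \<ge> 0\<close>])
      fix r
      have "((\<lambda>\<sigma>. - (D_tau \<theta> t \<sigma>)\<^sup>2 / 2) has_real_derivative - sin (\<theta> t r) * D_tau \<theta> t r)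
          (at r within {0..S})"
        using smooth_half_plane_has_derivative_s[OF smooth' \<open>t \<ge> 0\<close>, of r "{0..S}"]
        by (auto intro!: derivative_eq_intros simp: sine_Gordon[OF \<open>t \<ge> 0\<close>])
      then show "((\<lambda>\<sigma>. - (D_tau \<theta> t \<sigma>)\<^sup>2 / 2) has_vector_derivative - sin (\<theta> t r) * D_tau \<theta> t r)
          (at r within {0..S})"
        by (simp add: has_real_derivative_iff_has_vector_derivative)
    qed
    from integral_unique[OF this]
    have "integral (cbox 0 S) (\<lambda>\<sigma>. - sin (\<theta> t \<sigma>) * D_tau \<theta> t \<sigma>) = 0"
      using flux[OF \<open>t \<ge> 0\<close>] by simp
    ultimately show ?thesis
      by (simp only:)
  qed
  then have "\<exists>c. \<forall>t\<in>{0..}. I t = c"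
    by (intro has_field_derivative_zero_constant) auto
  then have "I \<tau> = I 0"
    using \<open>\<tau> \<ge> 0\<close> by auto
  moreover have "(LBINT \<sigma>=ereal 0..ereal S. cos (\<theta> t \<sigma>)) = I t" if "t \<ge> 0" for t
  proof -
    have "continuous_on {0..S} (\<lambda>\<sigma>. cos (\<theta> t \<sigma>))"
      by (intro continuous_on_cos smooth_half_plane_continuous_s smooth that)
    then have "set_integrable lborel {0..S} (\<lambda>\<sigma>. cos (\<theta> t \<sigma>))"
      by (rule borel_integrable_atLeastAtMost')
    then show ?thesis
      using interval_integral_eq_integral[of 0 S] \<open>S \<ge> 0\<close> by (simp add: I_def)
  qed
  ultimately show ?thesis
    using \<open>\<tau> \<ge> 0\<close> by simp
qed

theorem proposition2p8:
  fixes \<theta> x u :: "real \<Rightarrow> real \<Rightarrow> real" and S L :: real and n :: int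
  assumes "S > 0"
    and "smooth_half_plane \<theta>"
    and "\<And>\<tau> s. \<tau> \<ge> 0 \<Longrightarrow> D_s (D_tau \<theta>) \<tau> s = sin (\<theta> \<tau> s)"
    and "\<And>\<tau> s. \<tau> \<ge> 0 \<Longrightarrow> \<theta> \<tau> (s + S) = \<theta> \<tau> s + 2 * real_of_int n * pi"
    and "\<And>\<tau> s. \<tau> \<ge> 0 \<Longrightarrow> x \<tau> s = x \<tau> 0 + (LBINT \<sigma>=ereal 0..ereal s. cos (\<theta> \<tau> \<sigma>))"
    and "\<And>\<tau> s. \<tau> \<ge> 0 \<Longrightarrow> u \<tau> s = u \<tau> 0 + (LBINT \<sigma>=ereal 0..ereal s. sin (\<theta> \<tau> \<sigma>))"
    and "\<And>\<tau>. \<tau> \<ge> 0 \<Longrightarrow>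
           ((\<lambda>t. x t 0) has_real_derivative - ((D_tau \<theta> \<tau> 0)\<^sup>2 / 2)) (at \<tau> within {0..})"
    and "\<And>\<tau>. \<tau> \<ge> 0 \<Longrightarrow> u \<tau> 0 = D_tau \<theta> \<tau> 0"
    and "L = x 0 S - x 0 0"
  shows "\<forall>\<tau>\<ge>0. \<forall>s. x \<tau> (s + S) = x \<tau> s + L \<and> u \<tau> (s + S) = u \<tau> s"
proof (intro allI impI conjI)
  fix \<tau> s :: real
  assume "\<tau> \<ge> 0"
  note smooth = assms(2) and sine_Gordon = assms(3) and boundary = assms(4)
    and x_eq = assms(5) and u_eq = assms(6)
  have period: "D_tau \<theta> t (r + S) = D_tau \<theta> t r" if "t \<ge> 0" for t r
    using smooth that boundary by (rule D_tau_shift)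
  have u: "u \<tau> r = D_tau \<theta> \<tau> r" for r
    using u_eq[OF \<open>\<tau> \<ge> 0\<close>, of r] assms(8)[OF \<open>\<tau> \<ge> 0\<close>]
      integral_sin_sine_Gordon[OF smooth \<open>\<tau> \<ge> 0\<close> sine_Gordon[OF \<open>\<tau> \<ge> 0\<close>], of r]
    by simp
  show "u \<tau> (s + S) = u \<tau> s"
    using period[OF \<open>\<tau> \<ge> 0\<close>] by (simp add: u)
  have cos_period: "cos (\<theta> \<tau> (r + S)) = cos (\<theta> \<tau> r)" for r
    using boundary[OF \<open>\<tau> \<ge> 0\<close>, of r] cos_int_2pin[of n] sin_int_2pin[of n]
    by (simp add: cos_add ac_simps)
  have "x \<tau> (s + S) - x \<tau> s = (LBINT \<sigma>=ereal 0..ereal S. cos (\<theta> \<tau> \<sigma>))"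
    using x_eq[OF \<open>\<tau> \<ge> 0\<close>, of "s + S"] x_eq[OF \<open>\<tau> \<ge> 0\<close>, of s]
      interval_integral_add_period[OF continuous_on_cos[OF
        smooth_half_plane_continuous_s[OF smooth \<open>\<tau> \<ge> 0\<close>]], OF cos_period, of s]
    by linarith
  also have "\<dots> = (LBINT \<sigma>=ereal 0..ereal S. cos (\<theta> 0 \<sigma>))"
    using smooth \<open>\<tau> \<ge> 0\<close> less_imp_le[OF \<open>S > 0\<close>] sine_Gordon
    by (rule integral_cos_sine_Gordon_constant) (use period[of _ 0] in simp_all)
  also have "\<dots> = L"
    using x_eq[of 0 S] \<open>L = x 0 S - x 0 0\<close> by simp
  finally show "x \<tau> (s + S) = x \<tau> s + L"
    by simp
qed

end
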